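(* Let $\gamma=(x,y)\in H^1(\mathbb T;\mathbb R^2)$ be a $2\pi$-periodic curve satisfying, for all $t$, $$\gamma(t+\pi)=(x(t),-y(t)),\qquad \gamma\big(\tfrac{\pi}{2}+t\big)=\big(-x(\tfrac{\pi}{2}-t),\,y(\tfrac{\pi}{2}-t)\big).$$ Then $$\int_0^{2\pi}|\gamma(t)|^2\,dt\ \le\ \int_0^{2\pi}|\dot\gamma(t)|^2\,dt.$$
   Context: $\mathbb T:=\mathbb R/(2\pi\mathbb Z)$. *)

theory Defs
  imports "HOL-Analysis.Analysis"
begin

text \<open>Functions on the circle R/(2 pi Z) are represented by 2 pi-periodic functions on the real
  line. Elements of the Lebesgue and Sobolev spaces are represented by arbitrary Lebesgue measurable
  representatives; no continuous representative is singled out.\<close>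

definition periodic_T :: "(real \<Rightarrow> 'a) \<Rightarrow> bool" where
  "periodic_T f \<longleftrightarrow> (\<forall>t. f (t + 2 * pi) = f t)"

definition smooth_T :: "(real \<Rightarrow> real) set" where
  "smooth_T = {\<phi>. periodic_T \<phi> \<and> (\<forall>n. (deriv ^^ n) \<phi> differentiable_on UNIV)}"

definition L1_T :: "(real \<Rightarrow> 'a::euclidean_space) set" where
  "L1_T = {f. periodic_T f \<and> f \<in> borel_measurable lebesgue \<and>
              set_integrable lebesgue {0..2 * pi} f}"

definition L2_T :: "(real \<Rightarrow> 'a::euclidean_space) set" where
  "L2_T = {f. periodic_T f \<and> f \<in> borel_measurable lebesgue \<and>
              set_integrable lebesgue {0..2 * pi} (\<lambda>t. (norm (f t))\<^sup>2)}"

text \<open>Distributional derivative on the circle. Since test functions are periodic there are no boundary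
  terms, and the constant test functions force the derivative to have mean zero.
  The derivative is determined only up to null sets, hence a relation.\<close>

definition has_weak_derivative_T ::
    "(real \<Rightarrow> 'a::euclidean_space) \<Rightarrow> (real \<Rightarrow> 'a) \<Rightarrow> bool" where
  "has_weak_derivative_T f f' \<longleftrightarrow>
     f \<in> L1_T \<and> f' \<in> L1_T \<and>
     (\<forall>\<phi>\<in>smooth_T.
        (LINT t:{0..2 * pi}|lebesgue. deriv \<phi> t *\<^sub>R f t) =
        - (LINT t:{0..2 * pi}|lebesgue. \<phi> t *\<^sub>R f' t))"

definition H1_T :: "(real \<Rightarrow> 'a::euclidean_space) set" where
  "H1_T = {f. f \<in> L2_T \<and> (\<exists>f'\<in>L2_T. has_weak_derivative_T f f')}"

end

theory Submission
  imports Defs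
begin

text \<open>The two symmetries give \<open>\<gamma> (2\<pi> - t) = - \<gamma> t\<close>, so \<open>\<gamma>\<close> has mean zero and the claim is
  Wirtinger's inequality, which is proved by duality. For a smooth periodic \<open>p\<close> of mean zero there is
  a periodic primitive \<open>P\<close> with \<open>\<integral> P\<^sup>2 \<le> \<integral> p\<^sup>2\<close>, and the definition of the weak derivative gives
  \<open>2 \<integral> p f = - 2 \<integral> P f' \<le> \<integral> p\<^sup>2 + \<integral> f'\<^sup>2\<close>. Trigonometric polynomials approximate bounded measurable
  functions boundedly almost everywhere, so \<open>p\<close> may be replaced by truncations of \<open>f\<close>, which yields
  \<open>\<integral> f\<^sup>2 \<le> \<integral> f'\<^sup>2\<close>.\<close>

section \<open>Trigonometric polynomials\<close>

text \<open>The rules mirror those of \<open>real_polynomial_function\<close>, so restricting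
  polynomials to the unit circle is an induction. They also keep the set closed under
  \<open>deriv\<close>, whence smoothness of every order.\<close>

inductive_set trig_poly :: "(real \<Rightarrow> real) set" where
  const: "(\<lambda>t. c) \<in> trig_poly"
| cos: "cos \<in> trig_poly"
| sin: "sin \<in> trig_poly"
| add: "f \<in> trig_poly \<Longrightarrow> g \<in> trig_poly \<Longrightarrow> (\<lambda>t. f t + g t) \<in> trig_poly"
| mult: "f \<in> trig_poly \<Longrightarrow> g \<in> trig_poly \<Longrightarrow> (\<lambda>t. f t * g t) \<in> trig_poly"

lemma trig_poly_deriv:
  assumes "f \<in> trig_poly"
  shows "\<exists>f'\<in>trig_poly. \<forall>t. (f has_real_derivative f' t) (at t)"
  using assms
proof induction
  case (const c)
  show ?case
    by (rule bexI[OF _ trig_poly.const[of 0]]) auto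
next
  case cos
  have "(\<lambda>t. (- 1) * sin t) \<in> trig_poly"
    by (intro trig_poly.intros)
  then show ?case
    by (rule bexI[rotated]) (auto intro!: derivative_eq_intros)
next
  case sin
  show ?case
    by (rule bexI[OF _ trig_poly.cos]) (auto intro!: derivative_eq_intros)
next
  case (add f g)
  then obtain f' g' where "f' \<in> trig_poly" "g' \<in> trig_poly"
    "\<And>t. (f has_real_derivative f' t) (at t)" "\<And>t. (g has_real_derivative g' t) (at t)"
    by blast
  then show ?case
    by (intro bexI[of _ "\<lambda>t. f' t + g' t"]) (auto intro: trig_poly.add DERIV_add)
next
  case (mult f g)
  then obtain f' g' where "f' \<in> trig_poly" "g' \<in> trig_poly"
    "\<And>t. (f has_real_derivative f' t) (at t)" "\<And>t. (g has_real_derivative g' t) (at t)"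
    by blast
  with mult show ?case
    by (intro bexI[of _ "\<lambda>t. f' t * g t + g' t * f t"])
       (auto intro: trig_poly.intros DERIV_mult)
qed

lemma deriv_trig_poly: "f \<in> trig_poly \<Longrightarrow> deriv f \<in> trig_poly"
  using trig_poly_deriv[of f] by (metis DERIV_imp_deriv ext)

lemma trig_poly_smooth_T:
  assumes "f \<in> trig_poly"
  shows "f \<in> smooth_T"
proof -
  have "f (t + 2 * pi) = f t" for t
    using assms by induction auto
  moreover have "(deriv ^^ n) f \<in> trig_poly" for n
    by (induction n) (auto intro: assms deriv_trig_poly)
  then have "(deriv ^^ n) f differentiable_on UNIV" for n
    using trig_poly_deriv by (meson differentiable_on_def field_differentiable_def
        field_differentiable_imp_differentiable differentiable_at_withinI)
  ultimately show ?thesis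
    by (simp add: smooth_T_def periodic_T_def)
qed

text \<open>On the circle a real linear functional combines \<open>cos\<close> and
  \<open>sin\<close>, with its values at 1 and at the imaginary unit as coefficients. This turns
  Stone-Weierstrass on the circle into approximation by trigonometric polynomials.\<close>

lemma trig_poly_cis:
  fixes q :: "complex \<Rightarrow> real"
  assumes "real_polynomial_function q"
  shows "(\<lambda>t. q (cis t)) \<in> trig_poly"
  using assms
proof induction
  case (linear f)
  have "f (cis t) = f 1 * cos t + f \<i> * sin t" for t
  proof -
    have "cis t = cos t *\<^sub>R 1 + sin t *\<^sub>R \<i>"
      by (simp add: complex_eq_iff)
    then show ?thesis
      using linear by (simp only: linear_add linear_cmul bounded_linear.linear) simp
  qed
  then show ?case
    by (simp only:) (intro trig_poly.intros)
qed (auto intro: trig_poly.intros)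

text \<open>Cutting out a neighbourhood of the endpoints makes the approximated function live on a proper
  arc of the circle, from which it extends by Tietze without any matching condition.\<close>

lemma trig_poly_approx:
  fixes g :: "real \<Rightarrow> real"
  assumes g: "continuous_on UNIV g" and M: "\<And>t. \<bar>g t\<bar> \<le> M" and e: "0 < e"
  obtains p where "p \<in> trig_poly" "\<And>t. \<bar>p t\<bar> \<le> M + e"
    "\<And>t. e \<le> t \<Longrightarrow> t \<le> 2 * pi - e \<Longrightarrow> \<bar>p t - g t\<bar> \<le> e"
proof -
  define I where "I = {e..2 * pi - e}"
  \<comment> \<open>Angles in \<open>I\<close> stay strictly between 0 and 2 pi, where
    \<open>Arg2pi\<close> inverts \<open>cis\<close>; compactness of \<open>I\<close> makes the
    inverse continuous.\<close>
  have Arg: "Arg2pi (cis t) = t" if "t \<in> I" for t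
    using that e by (intro Arg2pi_unique[of 1]) (auto simp: I_def cis_conv_exp)
  have cont_cis: "continuous_on A cis" for A
    by (auto intro!: continuous_intros simp: cis_conv_exp)
  have "continuous_on (cis ` I) Arg2pi"
    by (intro continuous_on_inv cont_cis) (auto simp: I_def Arg[unfolded I_def])
  then have "continuous_on (cis ` I) (\<lambda>z. g (Arg2pi z))"
    by (intro continuous_on_compose2[OF g]) auto
  moreover have "closedin (top_of_set UNIV) (cis ` I)"
    by (auto simp: I_def intro!: compact_imp_closed compact_continuous_image cont_cis)
  moreover have "- M \<le> M" using M[of 0] by linarith
  moreover have "g (Arg2pi z) \<in> cbox (- M) M" for z
    using M[of "Arg2pi z"] by (simp add: abs_le_iff)
  \<comment> \<open>Tietze keeps the values in [-M, M], so the bound on the approximant also holds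
    on the arc where it need not follow \<open>g\<close>.\<close>
  ultimately obtain G where G: "continuous_on UNIV G"
      "\<And>z. z \<in> cis ` I \<Longrightarrow> G z = g (Arg2pi z)" "\<And>z. G z \<in> cbox (- M) M"
    by (rule Tietze_closed_interval_1) auto
  obtain q where q: "real_polynomial_function q" "\<And>z. z \<in> sphere (0::complex) 1 \<Longrightarrow> \<bar>G z - q z\<bar> < e"
    using Stone_Weierstrass_real_polynomial_function[OF compact_sphere continuous_on_subset[OF G(1)] e]
    by (metis subset_UNIV)
  have qG: "\<bar>G (cis t) - q (cis t)\<bar> < e" for t
    by (rule q) simp
  show thesis
  proof
    show "(\<lambda>t. q (cis t)) \<in> trig_poly"
      by (rule trig_poly_cis[OF q(1)])
    show "\<bar>q (cis t)\<bar> \<le> M + e" for t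
      using qG[of t] G(3)[of "cis t"] by auto
    show "\<bar>q (cis t) - g t\<bar> \<le> e" if "e \<le> t" "t \<le> 2 * pi - e" for t
    proof -
      have "t \<in> I" using that by (simp add: I_def)
      then have "G (cis t) = g t" by (subst G(2)) (auto simp: Arg)
      then show ?thesis using qG[of t] by linarith
    qed
  qed
qed

text \<open>A measurable function is an almost everywhere limit of continuous ones, and each of
  these is approximated off a shrinking neighbourhood of the endpoints. The uniform bound prepares
  for dominated convergence.\<close>

lemma bounded_measurable_approx:
  fixes h :: "real \<Rightarrow> real"
  assumes h: "h \<in> borel_measurable lebesgue" and M: "\<And>t. \<bar>h t\<bar> \<le> M"
  obtains p where "\<And>n. p n \<in> trig_poly" "\<And>n t. \<bar>p n t\<bar> \<le> M + 1"
    "AE t in lebesgue_on {0..2 * pi}. (\<lambda>n. p n t) \<longlonglongrightarrow> h t"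
proof -
  have "h measurable_on UNIV"
    by (rule lebesgue_measurable_imp_measurable_on[OF h]) auto
  then obtain N g where N: "negligible N" and g: "\<And>n. continuous_on UNIV (g n)"
      and lim: "\<And>t. t \<notin> N \<Longrightarrow> (\<lambda>n. g n t) \<longlonglongrightarrow> h t"
    unfolding measurable_on_def by auto
  have M0: "0 \<le> M" using M[of 0] by linarith
  \<comment> \<open>Clipping supplies the uniform bound and leaves the limit unchanged, since
    \<open>h\<close> already lies in [-M, M].\<close>
  define G where "G n t = max (- M) (min M (g n t))" for n t
  \<comment> \<open>One number serves both as accuracy and as width of the neighbourhood cut out at
    each endpoint; both must tend to 0.\<close>
  have "\<exists>p. p \<in> trig_poly \<and> (\<forall>t. \<bar>p t\<bar> \<le> M + inverse (real (Suc n))) \<and>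
      (\<forall>t. inverse (real (Suc n)) \<le> t \<longrightarrow> t \<le> 2 * pi - inverse (real (Suc n)) \<longrightarrow>
           \<bar>p t - G n t\<bar> \<le> inverse (real (Suc n)))" for n
  proof -
    have "continuous_on UNIV (G n)"
      unfolding G_def by (intro continuous_intros g)
    moreover have "\<bar>G n t\<bar> \<le> M" for t
      using M0 by (auto simp: G_def)
    ultimately show ?thesis
      by (rule trig_poly_approx[of "G n" M "inverse (real (Suc n))"]) auto
  qed
  then obtain p where p: "\<And>n. p n \<in> trig_poly" "\<And>n t. \<bar>p n t\<bar> \<le> M + inverse (real (Suc n))"
      "\<And>n t. inverse (real (Suc n)) \<le> t \<Longrightarrow> t \<le> 2 * pi - inverse (real (Suc n)) \<Longrightarrow>
           \<bar>p n t - G n t\<bar> \<le> inverse (real (Suc n))"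
    by metis
  have conv: "(\<lambda>n. p n t) \<longlonglongrightarrow> h t" if t: "t \<notin> N" "0 < t" "t < 2 * pi" for t
  proof -
    have "(\<lambda>n. G n t) \<longlonglongrightarrow> max (- M) (min M (h t))"
      unfolding G_def by (intro tendsto_intros lim t)
    also have "max (- M) (min M (h t)) = h t"
      using M[of t] by auto
    finally have 1: "(\<lambda>n. G n t) \<longlonglongrightarrow> h t" .
    \<comment> \<open>A fixed interior point eventually lies outside both neighbourhoods.\<close>
    have "\<forall>\<^sub>F n in sequentially. inverse (real (Suc n)) < min t (2 * pi - t)"
      using LIMSEQ_inverse_real_of_nat t by (intro order_tendstoD(2)) auto
    then have "\<forall>\<^sub>F n in sequentially. norm (p n t - G n t) \<le> inverse (real (Suc n))"
      by eventually_elim (use p(3) in auto)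
    then have "(\<lambda>n. p n t - G n t) \<longlonglongrightarrow> 0"
      using LIMSEQ_inverse_real_of_nat by (rule Lim_null_comparison)
    from tendsto_add[OF this 1] show ?thesis by simp
  qed
  have "N \<union> {0, 2 * pi} \<in> null_sets lebesgue"
    using N by (simp add: negligible_iff_null_sets[symmetric])
  then have "AE t in lebesgue. t \<notin> N \<union> {0, 2 * pi}"
    by (rule AE_not_in)
  then have ae: "AE t in lebesgue_on {0..2 * pi}. (\<lambda>n. p n t) \<longlonglongrightarrow> h t"
    by (subst AE_restrict_space_iff) (auto simp del: AE_conj_iff elim!: eventually_mono intro!: conv)
  show thesis
  proof
    show "\<bar>p n t\<bar> \<le> M + 1" for n t
      using p(2)[of n t] by (rule order_trans) (simp add: inverse_le_1_iff)
  qed (use p(1) ae in auto)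
qed

section \<open>Smooth periodic functions\<close>

lemma smooth_T_deriv:
  assumes "\<phi> \<in> smooth_T"
  shows "(\<phi> has_real_derivative deriv \<phi> t) (at t)"
proof -
  have "(deriv ^^ 0) \<phi> differentiable_on UNIV"
    using assms unfolding smooth_T_def by blast
  then show ?thesis
    by (simp add: differentiable_on_def DERIV_deriv_iff_real_differentiable)
qed

lemma smooth_T_continuous_on:
  assumes "\<phi> \<in> smooth_T"
  shows "continuous_on A \<phi>"
  using smooth_T_deriv[OF assms] by (meson DERIV_isCont continuous_at_imp_continuous_on)

text \<open>The increment \<open>P (t + 2 * pi) - P t\<close> has derivative 0 by periodicity of
  \<open>p\<close>, so it is constant; its value is the integral of \<open>p\<close> over a period,
  hence 0.\<close>

lemma smooth_T_primitive:
  assumes p: "p \<in> smooth_T" and mean: "integral {0..2 * pi} p = 0"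
  obtains P where "P \<in> smooth_T" "deriv P = p"
proof -
  have "\<exists>F. \<forall>t::real. - \<infinity> < ereal t \<longrightarrow> ereal t < \<infinity> \<longrightarrow> (F has_vector_derivative p t) (at t)"
    by (rule einterval_antiderivative)
       (auto intro: continuous_on_interior smooth_T_continuous_on[OF p] DERIV_isCont smooth_T_deriv[OF p])
  then obtain P where P: "\<And>t. (P has_real_derivative p t) (at t)"
    by (auto simp: has_real_derivative_iff_has_vector_derivative)
  have per: "P (t + 2 * pi) = P t" for t
  proof -
    have "((\<lambda>t. P (t + 2 * pi) - P t) has_real_derivative 0) (at t)" for t
    proof -
      have "((\<lambda>t. P (t + 2 * pi)) has_real_derivative p (t + 2 * pi)) (at t)"
        using P[of "t + 2 * pi"] by (rule iffD1[OF DERIV_shift])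
      from DERIV_diff[OF this P] show ?thesis
        using p by (simp add: smooth_T_def periodic_T_def)
    qed
    then have "P (t + 2 * pi) - P t = P (0 + 2 * pi) - P 0"
      by (rule DERIV_isconst_all[rule_format])
    also have "(p has_integral (P (2 * pi) - P 0)) {0..2 * pi}"
      by (rule fundamental_theorem_of_calculus)
         (auto intro: has_field_derivative_at_within[OF P]
               simp flip: has_real_derivative_iff_has_vector_derivative)
    then have "P (0 + 2 * pi) - P 0 = 0"
      using mean by (simp add: integral_unique)
    finally show ?thesis by simp
  qed
  have dP: "deriv P = p"
    using P by (auto intro: DERIV_imp_deriv)
  have "(deriv ^^ n) P differentiable_on UNIV" for n
  proof (cases n)
    case 0
    then show ?thesis
      using P by (auto simp: differentiable_on_def real_differentiable_def intro: differentiable_at_withinI)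
  next
    case (Suc m)
    then show ?thesis
      using p dP by (simp add: funpow_Suc_right smooth_T_def del: funpow.simps)
  qed
  with per dP show thesis
    by (intro that[of P]) (auto simp: smooth_T_def periodic_T_def)
qed

lemma smooth_T_diff_const:
  assumes "\<phi> \<in> smooth_T"
  shows "(\<lambda>t. \<phi> t - c) \<in> smooth_T" "deriv (\<lambda>t. \<phi> t - c) = deriv \<phi>"
proof -
  have d: "((\<lambda>t. \<phi> t - c) has_real_derivative deriv \<phi> t) (at t)" for t
    using DERIV_diff[OF smooth_T_deriv[OF assms] DERIV_const] by simp
  then show eq: "deriv (\<lambda>t. \<phi> t - c) = deriv \<phi>"
    by (auto intro: DERIV_imp_deriv)
  have "(deriv ^^ n) (\<lambda>t. \<phi> t - c) differentiable_on UNIV" for n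
  proof (cases n)
    case 0
    then show ?thesis
      using d by (auto simp: differentiable_on_def real_differentiable_def intro: differentiable_at_withinI)
  next
    case (Suc m)
    have "(deriv ^^ Suc m) \<phi> differentiable_on UNIV"
      using assms unfolding smooth_T_def by blast
    then show ?thesis
      using Suc eq by (simp add: funpow_Suc_right del: funpow.simps)
  qed
  then show "(\<lambda>t. \<phi> t - c) \<in> smooth_T"
    using assms by (simp add: smooth_T_def periodic_T_def)
qed

section \<open>Wirtinger's inequality for continuously differentiable functions\<close>

text \<open>At \<open>s\<close> the sine has a simple zero and \<open>Q\<close> vanishes at least to
  first order, so \<open>Q / sin\<close> has a finite limit, the quotient of the two derivatives.
  One factor \<open>Q\<close> is left over and forces the limit 0.\<close>

lemma tendsto_square_cot:
  fixes Q :: "real \<Rightarrow> real"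
  assumes Q: "(Q has_real_derivative d) (at s)" "Q s = 0" and "sin (s - a) = 0"
  shows "isCont (\<lambda>t. (Q t)\<^sup>2 * cot (t - a)) s"
proof -
  have cos: "cos (s - a) \<noteq> 0"
    using \<open>sin (s - a) = 0\<close> sin_cos_squared_add[of "s - a"] by auto
  have "((\<lambda>t. sin (t - a)) has_real_derivative cos (s - a)) (at s)"
    by (auto intro!: derivative_eq_intros)
  then have 1: "((\<lambda>t. sin (t - a) / (t - s)) \<longlongrightarrow> cos (s - a)) (at s)"
    using \<open>sin (s - a) = 0\<close> by (simp add: has_field_derivative_iff)
  have 2: "((\<lambda>t. Q t / (t - s)) \<longlongrightarrow> d) (at s)"
    using Q by (simp add: has_field_derivative_iff)
  have "((\<lambda>t. Q t / (t - s) / (sin (t - a) / (t - s))) \<longlongrightarrow> d / cos (s - a)) (at s)"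
    by (intro tendsto_divide 1 2 cos)
  then have 3: "((\<lambda>t. Q t / sin (t - a)) \<longlongrightarrow> d / cos (s - a)) (at s)"
    by (rule Lim_transform_eventually) (auto simp: eventually_at_filter)
  have 4: "((\<lambda>t. Q t) \<longlongrightarrow> 0) (at s)"
    using DERIV_isCont[OF Q(1)] Q(2) by (simp add: isCont_def)
  have "((\<lambda>t. Q t * (Q t / sin (t - a)) * cos (t - a)) \<longlongrightarrow> 0 * (d / cos (s - a)) * cos (s - a)) (at s)"
    by (intro tendsto_intros 3 4)
  then show ?thesis
    using Q(2) by (simp add: isCont_def cot_def power2_eq_square ac_simps)
qed

text \<open>With \<open>P\<close> taking the same value \<open>c\<close> at \<open>a\<close> and \<open>a + \<pi>\<close>, the function
  \<open>Q = P - c\<close> satisfies \<open>Q'\<^sup>2 - Q\<^sup>2 = (Q' - Q cot (t - a))\<^sup>2 + (Q\<^sup>2 cot (t - a))'\<close>,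
  and the last term integrates to zero over a period. At the zeros of the sine, \<open>cot\<close> has the junk
  value 0, which is the limit of \<open>Q\<^sup>2 cot (t - a)\<close> there.\<close>

lemma wirtinger_C1:
  fixes P p :: "real \<Rightarrow> real"
  assumes P: "\<And>t. (P has_real_derivative p t) (at t)" and p: "continuous_on UNIV p"
    and per: "\<And>t. P (t + 2 * pi) = P t"
  obtains c where "integral {0..2 * pi} (\<lambda>t. (P t - c)\<^sup>2) \<le> integral {0..2 * pi} (\<lambda>t. (p t)\<^sup>2)"
proof -
  have contP: "continuous_on A P" for A
    using P by (meson DERIV_isCont continuous_at_imp_continuous_on)
  \<comment> \<open>By periodicity this difference takes opposite values at 0 and at pi, so it has a
    zero \<open>a\<close> in between.\<close>
  have "continuous_on {0..pi} (\<lambda>t. P (t + pi) - P t)"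
    by (intro continuous_intros contP continuous_on_compose2[OF contP[of UNIV]]) auto
  moreover have "P (pi + pi) = P 0"
    using per[of 0] by simp
  ultimately have "\<exists>a. 0 \<le> a \<and> a \<le> pi \<and> P (a + pi) - P a = 0"
    using IVT'[of "\<lambda>t. P (t + pi) - P t" 0 0 pi] IVT2'[of "\<lambda>t. P (t + pi) - P t" pi 0 0]
    by (cases "P pi \<le> P 0") auto
  then obtain a where a: "0 \<le> a" "a \<le> pi" "P (a + pi) = P a" by auto
  define Q where "Q t = P t - P a" for t
  have Q: "(Q has_real_derivative p t) (at t)" for t
    unfolding Q_def using DERIV_diff[OF P DERIV_const] by simp
  have contQ: "continuous_on A Q" for A
    using Q by (meson DERIV_isCont continuous_at_imp_continuous_on)
  \<comment> \<open>Since \<open>a\<close> lies in [0, pi], \<open>t - a\<close> ranges over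
    [-pi, 2 pi], which leaves four multiples of pi. At all of them \<open>Q\<close> vanishes by
    periodicity.\<close>
  have zero: "t \<in> {a - pi, a, a + pi, a + 2 * pi}" if "sin (t - a) = 0" "0 \<le> t" "t \<le> 2 * pi" for t
  proof -
    obtain k :: int where k: "t - a = of_int k * pi"
      using \<open>sin (t - a) = 0\<close> by (auto simp: sin_zero_iff_int2)
    have "- 1 * pi \<le> of_int k * pi" "of_int k * pi \<le> 2 * pi"
      using k that a by linarith+
    then have "- 1 \<le> real_of_int k" "real_of_int k \<le> 2"
      by (simp_all only: mult_le_cancel_right) (use pi_gt_zero in auto)
    then have "k \<in> {-1, 0, 1, 2}" by auto
    then show ?thesis using k by auto
  qed
  have Q0: "Q t = 0" if "t \<in> {a - pi, a, a + pi, a + 2 * pi}" for t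
    using that a per[of a] per[of "a - pi"] by (auto simp: Q_def add.commute)
  define H where "H t = (Q t)\<^sup>2 * cot (t - a)" for t
  \<comment> \<open>By construction \<open>p\<close>^2 - \<open>Q\<close>^2 - \<open>K\<close> is a
    square; where the sine is nonzero, \<open>K\<close> is the derivative of
    \<open>H\<close>.\<close>
  define K where "K t = (p t)\<^sup>2 - (Q t)\<^sup>2 - (p t - Q t * cot (t - a))\<^sup>2" for t
  have contH: "isCont H t" if "0 \<le> t" "t \<le> 2 * pi" for t
  proof (cases "sin (t - a) = 0")
    case True
    then show ?thesis
      unfolding H_def using that zero Q0 by (intro tendsto_square_cot[OF Q]) auto
  next
    case False
    then show ?thesis
      unfolding H_def by (intro continuous_intros DERIV_isCont[OF Q] isCont_cot) auto
  qed
  have derH: "(H has_real_derivative K t) (at t)" if s: "sin (t - a) \<noteq> 0" for t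
  proof -
    have "((\<lambda>t. cot (t - a)) has_real_derivative - inverse ((sin (t - a))\<^sup>2)) (at t)"
      using DERIV_cot[OF s] DERIV_shift[of cot _ t "- a"] by simp
    from DERIV_mult[OF DERIV_power[OF Q, of 2] this]
    have "(H has_real_derivative 2 * p t * Q t * cot (t - a) - (Q t)\<^sup>2 * inverse ((sin (t - a))\<^sup>2)) (at t)"
      by (simp add: H_def[abs_def] ac_simps)
    moreover have "inverse ((sin (t - a))\<^sup>2) = 1 + (cot (t - a))\<^sup>2"
      using s sin_cos_squared_add[of "t - a"] by (simp add: cot_def power_divide field_simps)
    ultimately show ?thesis
      by (simp add: K_def power2_eq_square algebra_simps)
  qed
  \<comment> \<open>The fundamental theorem tolerates finitely many points without a derivative,
    here the zeros of the sine, as \<open>H\<close> is continuous there.\<close>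
  have "(K has_integral (H (2 * pi) - H 0)) {0..2 * pi}"
  proof (rule fundamental_theorem_of_calculus_strong[of "{a - pi, a, a + pi, a + 2 * pi}"])
    show "continuous_on {0..2 * pi} H"
      using contH by (auto intro: continuous_at_imp_continuous_on)
    show "(H has_vector_derivative K t) (at t)"
      if "t \<in> {0..2 * pi} - {a - pi, a, a + pi, a + 2 * pi}" for t
      using that zero[of t] derH[of t] by (auto simp: has_real_derivative_iff_has_vector_derivative)
  qed auto
  moreover have "cot (2 * pi - a) = cot (0 - a)"
    by (simp add: cot_def sin_diff cos_diff)
  then have "H (2 * pi) - H 0 = 0"
    using per[of 0] by (simp add: H_def Q_def)
  ultimately have K: "(K has_integral 0) {0..2 * pi}" by simp
  have int: "(\<lambda>t. (p t)\<^sup>2) integrable_on {0..2 * pi}" "(\<lambda>t. (Q t)\<^sup>2) integrable_on {0..2 * pi}"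
    by (intro integrable_continuous_interval continuous_intros contQ continuous_on_subset[OF p]; simp)+
  have "0 \<le> integral {0..2 * pi} (\<lambda>t. (p t)\<^sup>2) - integral {0..2 * pi} (\<lambda>t. (Q t)\<^sup>2) - 0"
  proof (rule has_integral_nonneg)
    show "((\<lambda>t. (p t)\<^sup>2 - (Q t)\<^sup>2 - K t) has_integral
        integral {0..2 * pi} (\<lambda>t. (p t)\<^sup>2) - integral {0..2 * pi} (\<lambda>t. (Q t)\<^sup>2) - 0) {0..2 * pi}"
      by (intro has_integral_diff integrable_integral int K)
  qed (simp add: K_def)
  then show thesis
    by (intro that[of "P a"]) (simp add: Q_def)
qed

section \<open>Weakly differentiable periodic functions\<close>

abbreviation circle :: "real measure" where
  "circle \<equiv> lebesgue_on {0..2 * pi}"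

lemma set_lebesgue_integral_circle:
  fixes f :: "real \<Rightarrow> 'a::euclidean_space"
  shows "(LINT t:{0..2 * pi}|lebesgue. f t) = integral\<^sup>L circle f"
  by (simp add: set_lebesgue_integral_def integral_restrict_space)

lemma set_integrable_circle:
  fixes f :: "real \<Rightarrow> 'a::euclidean_space"
  shows "set_integrable lebesgue {0..2 * pi} f \<longleftrightarrow> integrable circle f"
  by (simp add: set_integrable_def integrable_restrict_space)

lemma has_weak_derivative_T_integrable:
  assumes "has_weak_derivative_T f f'"
  shows "integrable circle f" "integrable circle f'"
    "f \<in> borel_measurable lebesgue" "f' \<in> borel_measurable lebesgue"
  using assms by (auto simp: has_weak_derivative_T_def L1_T_def set_integrable_circle)

lemma has_weak_derivative_T_integral:
  assumes "has_weak_derivative_T f f'" "\<phi> \<in> smooth_T"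
  shows "(\<integral>t. deriv \<phi> t *\<^sub>R f t \<partial>circle) = - (\<integral>t. \<phi> t *\<^sub>R f' t \<partial>circle)"
  using assms by (auto simp: has_weak_derivative_T_def set_lebesgue_integral_circle)

lemma borel_measurable_circle:
  "f \<in> borel_measurable lebesgue \<Longrightarrow> f \<in> borel_measurable circle"
  by (rule measurable_restrict_space1)

lemma integrable_circle_continuous:
  fixes f :: "real \<Rightarrow> real"
  shows "continuous_on UNIV f \<Longrightarrow> integrable circle f"
  by (rule continuous_imp_integrable_real) (auto intro: continuous_on_subset)

lemma integrable_bounded_scaleR:
  fixes f :: "'a \<Rightarrow> 'b::{banach, second_countable_topology}" and g :: "'a \<Rightarrow> real"
  assumes f: "integrable M f" and g: "g \<in> borel_measurable M" "\<And>t. t \<in> space M \<Longrightarrow> \<bar>g t\<bar> \<le> C"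
  shows "integrable M (\<lambda>t. g t *\<^sub>R f t)"
proof (rule Bochner_Integration.integrable_bound)
  show "integrable M (\<lambda>t. C *\<^sub>R f t)" using f by simp
  show "AE t in M. norm (g t *\<^sub>R f t) \<le> norm (C *\<^sub>R f t)"
  proof (rule AE_I2)
    fix t assume "t \<in> space M"
    then have "\<bar>g t\<bar> * norm (f t) \<le> \<bar>C\<bar> * norm (f t)"
      by (intro mult_right_mono order_trans[OF g(2) abs_ge_self]) auto
    then show "norm (g t *\<^sub>R f t) \<le> norm (C *\<^sub>R f t)" by simp
  qed
qed (use f g in measurable)

lemma integrable_circle_scaleR:
  fixes f :: "real \<Rightarrow> 'a::euclidean_space" and u :: "real \<Rightarrow> real"
  assumes u: "continuous_on UNIV u" and f: "integrable circle f"
  shows "integrable circle (\<lambda>t. u t *\<^sub>R f t)"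
proof -
  have "compact (u ` {0..2 * pi})"
    by (intro compact_continuous_image continuous_on_subset[OF u]) auto
  then obtain C where "\<And>y. y \<in> u ` {0..2 * pi} \<Longrightarrow> norm y \<le> C"
    by (meson compact_imp_bounded bounded_iff)
  then have "\<bar>u t\<bar> \<le> C" if "t \<in> space circle" for t
    using that by simp
  with f borel_measurable_integrable[OF integrable_circle_continuous[OF u]] show ?thesis
    by (rule integrable_bounded_scaleR)
qed

lemma integrable_mult_square:
  fixes f g :: "real \<Rightarrow> real"
  assumes [measurable]: "f \<in> borel_measurable M" "g \<in> borel_measurable M"
    and "integrable M (\<lambda>t. (f t)\<^sup>2)" "integrable M (\<lambda>t. (g t)\<^sup>2)"
  shows "integrable M (\<lambda>t. f t * g t)"
proof (rule Bochner_Integration.integrable_bound)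
  show "integrable M (\<lambda>t. (f t)\<^sup>2 + (g t)\<^sup>2)" using assms by simp
  show "AE t in M. norm (f t * g t) \<le> norm ((f t)\<^sup>2 + (g t)\<^sup>2)"
  proof (rule AE_I2)
    fix t
    have "2 * (\<bar>f t\<bar> * \<bar>g t\<bar>) \<le> (f t)\<^sup>2 + (g t)\<^sup>2"
      using sum_squares_bound[of "\<bar>f t\<bar>" "\<bar>g t\<bar>"] by simp
    moreover have "0 \<le> \<bar>f t\<bar> * \<bar>g t\<bar>" by simp
    ultimately have "\<bar>f t\<bar> * \<bar>g t\<bar> \<le> (f t)\<^sup>2 + (g t)\<^sup>2" by linarith
    then show "norm (f t * g t) \<le> norm ((f t)\<^sup>2 + (g t)\<^sup>2)"
      by (simp add: abs_mult)
  qed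
qed simp

lemma smooth_T_deriv_continuous_on:
  assumes "\<phi> \<in> smooth_T"
  shows "continuous_on A (deriv \<phi>)"
proof -
  have "(deriv ^^ 1) \<phi> differentiable_on UNIV"
    using assms unfolding smooth_T_def by blast
  then show ?thesis
    by (auto dest: differentiable_imp_continuous_on intro: continuous_on_subset)
qed

section \<open>The duality argument\<close>

text \<open>The weak derivative moves \<open>f\<close> to \<open>f'\<close> at the price of
  replacing the test function by a primitive, whose square integral is controlled by the classical
  inequality. What remains is -2ab <= a^2 + b^2.\<close>

lemma weak_pairing_le_smooth:
  fixes f f' :: "real \<Rightarrow> real"
  assumes weak: "has_weak_derivative_T f f'" and mean: "integral\<^sup>L circle f = 0"
    and f': "integrable circle (\<lambda>t. (f' t)\<^sup>2)" and p: "p \<in> smooth_T"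
  shows "2 * (\<integral>t. p t * f t \<partial>circle) \<le> (\<integral>t. (p t)\<^sup>2 \<partial>circle) + (\<integral>t. (f' t)\<^sup>2 \<partial>circle)"
proof -
  note f = has_weak_derivative_T_integrable[OF weak]
  note contp = smooth_T_continuous_on[OF p]
  have eq: "integral\<^sup>L circle u = integral {0..2 * pi} u" if "continuous_on UNIV u" for u :: "real \<Rightarrow> real"
    using integrable_circle_continuous[OF that] by (rule lebesgue_integral_eq_integral) simp
  \<comment> \<open>Only after subtraction of its mean \<open>m\<close> does \<open>p\<close> have a
    periodic primitive.\<close>
  define m where "m = (\<integral>t. p t \<partial>circle) / (2 * pi)"
  have len: "(\<integral>t. c \<partial>circle) = c * (2 * pi)" for c :: real
    by (subst eq) auto
  have int: "integrable circle p" "integrable circle (\<lambda>t. (p t)\<^sup>2)"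
    by (intro integrable_circle_continuous continuous_intros contp)+
  define q where "q t = p t - m" for t
  have q: "q \<in> smooth_T"
    using smooth_T_diff_const(1)[OF p, of m] by (simp add: q_def[abs_def])
  have "integral\<^sup>L circle q = 0"
    using int len[of m] by (simp add: q_def[abs_def] m_def)
  then obtain P0 where P0: "P0 \<in> smooth_T" "deriv P0 = q"
    using smooth_T_primitive[OF q] eq[OF smooth_T_continuous_on[OF q]] by metis
  obtain c where c: "integral {0..2 * pi} (\<lambda>t. (P0 t - c)\<^sup>2) \<le> integral {0..2 * pi} (\<lambda>t. (q t)\<^sup>2)"
  proof (rule wirtinger_C1[of P0 q])
    show "(P0 has_real_derivative q t) (at t)" for t
      using smooth_T_deriv[OF P0(1)] P0(2) by simp
    show "P0 (t + 2 * pi) = P0 t" for t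
      using P0(1) by (simp add: smooth_T_def periodic_T_def)
  qed (use smooth_T_continuous_on[OF q] in auto)
  note contP0 = smooth_T_continuous_on[OF P0(1)]
  define P where "P t = P0 t - c" for t
  have P: "P \<in> smooth_T" "deriv P = q"
    using smooth_T_diff_const[OF P0(1), of c] P0(2) by (simp_all add: P_def[abs_def])
  note contP = smooth_T_continuous_on[OF P(1)] and contq = smooth_T_continuous_on[OF q]
  have Pq: "(\<integral>t. (P t)\<^sup>2 \<partial>circle) \<le> (\<integral>t. (q t)\<^sup>2 \<partial>circle)"
    using c by (subst (1 2) eq) (auto intro!: continuous_intros contP0 contq simp: P_def)
  \<comment> \<open>Removing the mean lowers the square integral by exactly 2 pi m^2.\<close>
  have "(\<integral>t. (q t)\<^sup>2 \<partial>circle) = (\<integral>t. (p t)\<^sup>2 - 2 * m * p t + m\<^sup>2 \<partial>circle)"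
    by (simp add: q_def power2_diff algebra_simps)
  also have "\<dots> = (\<integral>t. (p t)\<^sup>2 \<partial>circle) - 2 * m * (\<integral>t. p t \<partial>circle) + (\<integral>t. m\<^sup>2 \<partial>circle)"
    using int by simp
  also have "\<dots> = (\<integral>t. (p t)\<^sup>2 \<partial>circle) - m\<^sup>2 * (2 * pi)"
    unfolding len by (simp add: m_def power2_eq_square)
  finally have qp: "(\<integral>t. (q t)\<^sup>2 \<partial>circle) \<le> (\<integral>t. (p t)\<^sup>2 \<partial>circle)"
    by simp
  have "integrable circle (\<lambda>t. p t * f t)"
    using integrable_circle_scaleR[OF contp f(1)] by simp
  \<comment> \<open>The constant \<open>m\<close> contributes nothing here because \<open>f\<close>
    has mean zero.\<close>
  then have "(\<integral>t. p t * f t \<partial>circle) = (\<integral>t. q t * f t \<partial>circle)"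
    using f mean by (simp add: q_def left_diff_distrib)
  also have "\<dots> = - (\<integral>t. P t * f' t \<partial>circle)"
    using has_weak_derivative_T_integral[OF weak P(1)] P(2) by simp
  finally have 1: "2 * (\<integral>t. p t * f t \<partial>circle) = (\<integral>t. - 2 * (P t * f' t) \<partial>circle)"
    by simp
  have intP: "integrable circle (\<lambda>t. (P t)\<^sup>2)"
    by (intro integrable_circle_continuous continuous_intros contP)
  have intPf: "integrable circle (\<lambda>t. P t * f' t)"
    using integrable_circle_continuous[OF contP] f(2) intP f' by (intro integrable_mult_square) auto
  have "(\<integral>t. - 2 * (P t * f' t) \<partial>circle) \<le> (\<integral>t. (P t)\<^sup>2 + (f' t)\<^sup>2 \<partial>circle)"
  proof (rule integral_mono)
    show "- 2 * (P t * f' t) \<le> (P t)\<^sup>2 + (f' t)\<^sup>2" for t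
      using zero_le_power2[of "P t + f' t"] by (simp add: power2_sum)
  qed (use intP intPf f' in auto)
  also have "\<dots> = (\<integral>t. (P t)\<^sup>2 \<partial>circle) + (\<integral>t. (f' t)\<^sup>2 \<partial>circle)"
    using intP f' by simp
  finally show ?thesis using 1 Pq qp by linarith
qed

lemma tendsto_integral_bounded_mult:
  fixes f h :: "real \<Rightarrow> real"
  assumes f: "integrable M f" and p: "\<And>n. p n \<in> borel_measurable M" "\<And>n t. \<bar>p n t\<bar> \<le> C"
    and h: "h \<in> borel_measurable M" and lim: "AE t in M. (\<lambda>n. p n t) \<longlonglongrightarrow> h t"
  shows "(\<lambda>n. \<integral>t. p n t * f t \<partial>M) \<longlonglongrightarrow> (\<integral>t. h t * f t \<partial>M)"
proof (rule integral_dominated_convergence)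
  show "integrable M (\<lambda>t. C * \<bar>f t\<bar>)" using f by simp
  show "AE t in M. (\<lambda>n. p n t * f t) \<longlonglongrightarrow> h t * f t"
    using lim by eventually_elim (intro tendsto_intros)
  show "AE t in M. norm (p n t * f t) \<le> C * \<bar>f t\<bar>" for n
    using p(2) by (auto simp: abs_mult intro!: AE_I2 mult_right_mono)
qed (use f p h in measurable)

text \<open>Boundedly convergent trigonometric polynomials carry the smooth case to
  \<open>h\<close>: the pairing is dominated by a multiple of |f|, the squares by a
  constant.\<close>

lemma weak_pairing_le_bounded:
  fixes f f' h :: "real \<Rightarrow> real"
  assumes weak: "has_weak_derivative_T f f'" and mean: "integral\<^sup>L circle f = 0"
    and f': "integrable circle (\<lambda>t. (f' t)\<^sup>2)"
    and h: "h \<in> borel_measurable lebesgue" and M: "\<And>t. \<bar>h t\<bar> \<le> M"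
  shows "2 * (\<integral>t. h t * f t \<partial>circle) \<le> (\<integral>t. (h t)\<^sup>2 \<partial>circle) + (\<integral>t. (f' t)\<^sup>2 \<partial>circle)"
proof -
  note f = has_weak_derivative_T_integrable[OF weak]
  obtain p where p: "\<And>n. p n \<in> trig_poly" "\<And>n t. \<bar>p n t\<bar> \<le> M + 1"
      "AE t in circle. (\<lambda>n. p n t) \<longlonglongrightarrow> h t"
    using bounded_measurable_approx[OF h M] by blast
  have smooth: "p n \<in> smooth_T" for n
    by (rule trig_poly_smooth_T[OF p(1)])
  have meas: "p n \<in> borel_measurable circle" for n
    using integrable_circle_continuous[OF smooth_T_continuous_on[OF smooth]] by auto
  have hm: "h \<in> borel_measurable circle"
    by (rule borel_measurable_circle[OF h])
  have 1: "(\<lambda>n. \<integral>t. p n t * f t \<partial>circle) \<longlonglongrightarrow> (\<integral>t. h t * f t \<partial>circle)"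
    by (rule tendsto_integral_bounded_mult[OF f(1) meas p(2) hm p(3)])
  \<comment> \<open>The factor 1 lets the same convergence lemma apply, with the constant function 1
    as integrable factor.\<close>
  have "(\<lambda>n. \<integral>t. (p n t)\<^sup>2 * 1 \<partial>circle) \<longlonglongrightarrow> (\<integral>t. (h t)\<^sup>2 * 1 \<partial>circle)"
  proof (rule tendsto_integral_bounded_mult)
    show "\<bar>(p n t)\<^sup>2\<bar> \<le> (M + 1)\<^sup>2" for n t
      using power_mono[OF p(2)[of n t], of 2] by simp
    show "AE t in circle. (\<lambda>n. (p n t)\<^sup>2) \<longlonglongrightarrow> (h t)\<^sup>2"
      using p(3) by eventually_elim (intro tendsto_intros)
  qed (use meas hm in auto)
  then have 2: "(\<lambda>n. \<integral>t. (p n t)\<^sup>2 \<partial>circle) \<longlonglongrightarrow> (\<integral>t. (h t)\<^sup>2 \<partial>circle)"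
    by simp
  show ?thesis
    by (rule LIMSEQ_le[OF tendsto_mult_left[OF 1] tendsto_add[OF 2 tendsto_const]])
       (use weak_pairing_le_smooth[OF weak mean f' smooth] in auto)
qed

text \<open>As \<open>f\<close> may be unbounded, its truncations \<open>h n\<close> are the test
  functions. From \<open>h\<close>^2 <= \<open>h\<close> \<open>f\<close> the pairing bound becomes
  twice the integral of \<open>h\<close>^2 <= that integral + the integral of \<open>f'\<close>^2;
  one copy cancels, and \<open>n\<close> tends to infinity.\<close>

lemma wirtinger_weak_real:
  fixes f f' :: "real \<Rightarrow> real"
  assumes weak: "has_weak_derivative_T f f'" and mean: "integral\<^sup>L circle f = 0"
    and f: "integrable circle (\<lambda>t. (f t)\<^sup>2)" and f': "integrable circle (\<lambda>t. (f' t)\<^sup>2)"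
  shows "(\<integral>t. (f t)\<^sup>2 \<partial>circle) \<le> (\<integral>t. (f' t)\<^sup>2 \<partial>circle)"
proof -
  note fi = has_weak_derivative_T_integrable[OF weak]
  define h where "h n t = max (- real n) (min (real n) (f t))" for n t
  have h: "h n \<in> borel_measurable lebesgue" for n
    unfolding h_def using fi(3) by measurable
  note hm = borel_measurable_circle[OF h]
  have hn: "\<bar>h n t\<bar> \<le> real n" for n t
    by (auto simp: h_def)
  \<comment> \<open>Truncation keeps the sign of \<open>f\<close> and does not increase its modulus;
    both square estimates follow.\<close>
  have sign: "0 \<le> h n t \<and> h n t \<le> f t \<or> f t \<le> h n t \<and> h n t \<le> 0" for n t
    by (auto simp: h_def)
  have hf: "(h n t)\<^sup>2 \<le> h n t * f t" for n t
    using sign[of n t] unfolding power2_eq_square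
    by (auto intro: mult_left_mono mult_left_mono_neg)
  have hf2: "(h n t)\<^sup>2 \<le> (f t)\<^sup>2" for n t
    using sign[of n t] by (auto simp: abs_le_square_iff[symmetric])
  have hint: "integrable circle (\<lambda>t. (h n t)\<^sup>2)" for n
    by (rule Bochner_Integration.integrable_bound[OF f]) (use hm hf2 in auto)
  have le: "(\<integral>t. (h n t)\<^sup>2 \<partial>circle) \<le> (\<integral>t. (f' t)\<^sup>2 \<partial>circle)" for n
  proof -
    have "(\<integral>t. (h n t)\<^sup>2 \<partial>circle) \<le> (\<integral>t. h n t * f t \<partial>circle)"
      by (rule integral_mono[OF hint _ hf])
         (use integrable_bounded_scaleR[OF fi(1) hm hn] in simp)
    then show ?thesis
      using weak_pairing_le_bounded[OF weak mean f' h hn, of n] by linarith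
  qed
  have "(\<lambda>n. \<integral>t. (h n t)\<^sup>2 \<partial>circle) \<longlonglongrightarrow> (\<integral>t. (f t)\<^sup>2 \<partial>circle)"
  proof (rule integral_dominated_convergence[OF _ _ f])
    have "(\<lambda>n. (h n t)\<^sup>2) \<longlonglongrightarrow> (f t)\<^sup>2" for t
    proof (rule tendsto_eventually)
      obtain N :: nat where "\<bar>f t\<bar> \<le> N" using real_arch_simple by blast
      then have "h n t = f t" if "N \<le> n" for n
        using that by (auto simp: h_def)
      then show "\<forall>\<^sub>F n in sequentially. (h n t)\<^sup>2 = (f t)\<^sup>2"
        by (intro eventually_sequentiallyI[of N]) simp
    qed
    then show "AE t in circle. (\<lambda>n. (h n t)\<^sup>2) \<longlonglongrightarrow> (f t)\<^sup>2" by simp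
  qed (use hm hf2 fi(1) in auto)
  then show ?thesis
    by (rule LIMSEQ_le_const2) (use le in auto)
qed

section \<open>Uniqueness of the weak derivative and vector-valued functions\<close>

text \<open>Testing with approximations of the sign of \<open>g\<close> gives in the limit that the
  integral of |g| is 0. The sign is bounded, so integrability of \<open>g\<close> suffices.\<close>

lemma smooth_T_orthogonal_imp_AE_0:
  fixes g :: "real \<Rightarrow> real"
  assumes g: "g \<in> borel_measurable lebesgue" "integrable circle g"
    and orth: "\<And>\<phi>. \<phi> \<in> smooth_T \<Longrightarrow> (\<integral>t. \<phi> t * g t \<partial>circle) = 0"
  shows "AE t in circle. g t = 0"
proof -
  have h: "(\<lambda>t. sgn (g t)) \<in> borel_measurable lebesgue"
    using g(1) by measurable
  obtain p where p: "\<And>n. p n \<in> trig_poly" "\<And>n t. \<bar>p n t\<bar> \<le> 1 + 1"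
      "AE t in circle. (\<lambda>n. p n t) \<longlonglongrightarrow> sgn (g t)"
    by (rule bounded_measurable_approx[OF h, of 1]) (auto simp: sgn_if)
  have smooth: "p n \<in> smooth_T" for n
    by (rule trig_poly_smooth_T[OF p(1)])
  have meas: "p n \<in> borel_measurable circle" for n
    using integrable_circle_continuous[OF smooth_T_continuous_on[OF smooth]] by auto
  have "(\<lambda>n. \<integral>t. p n t * g t \<partial>circle) \<longlonglongrightarrow> (\<integral>t. sgn (g t) * g t \<partial>circle)"
    by (rule tendsto_integral_bounded_mult[OF g(2) meas p(2) borel_measurable_circle[OF h] p(3)])
  then have "(\<integral>t. \<bar>g t\<bar> \<partial>circle) = 0"
    using orth[OF smooth] by (simp add: LIMSEQ_const_iff mult.commute[of "sgn _"] flip: abs_sgn)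
  then show ?thesis
    using g(2) by (subst (asm) integral_nonneg_eq_0_iff_AE) auto
qed

lemma has_weak_derivative_T_inner:
  assumes "has_weak_derivative_T f f'"
  shows "has_weak_derivative_T (\<lambda>t. f t \<bullet> b) (\<lambda>t. f' t \<bullet> b)"
proof -
  note f = has_weak_derivative_T_integrable[OF assms]
  have "(\<integral>t. deriv \<phi> t *\<^sub>R (f t \<bullet> b) \<partial>circle) = - (\<integral>t. \<phi> t *\<^sub>R (f' t \<bullet> b) \<partial>circle)"
    if \<phi>: "\<phi> \<in> smooth_T" for \<phi>
  proof -
    have "(\<integral>t. (deriv \<phi> t *\<^sub>R f t) \<bullet> b \<partial>circle) = - (\<integral>t. (\<phi> t *\<^sub>R f' t) \<bullet> b \<partial>circle)"
      by (subst (1 2) integral_inner_left)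
         (simp_all add: has_weak_derivative_T_integral[OF assms \<phi>] integrable_circle_scaleR f
           smooth_T_deriv_continuous_on[OF \<phi>] smooth_T_continuous_on[OF \<phi>])
    then show ?thesis by simp
  qed
  then show ?thesis
    using assms f
    by (auto simp: has_weak_derivative_T_def L1_T_def periodic_T_def set_integrable_circle
        set_lebesgue_integral_circle)
qed

lemma has_weak_derivative_T_unique_AE:
  assumes 1: "has_weak_derivative_T f g1" and 2: "has_weak_derivative_T f g2"
  shows "AE t in circle. g1 t = g2 t"
proof -
  have "AE t in circle. g1 t \<bullet> b - g2 t \<bullet> b = 0" for b
  proof (rule smooth_T_orthogonal_imp_AE_0)
    note 1 = has_weak_derivative_T_inner[OF 1, of b] and 2 = has_weak_derivative_T_inner[OF 2, of b]
    note i = has_weak_derivative_T_integrable(2,4)[OF 1] has_weak_derivative_T_integrable(2,4)[OF 2]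
    show "(\<lambda>t. g1 t \<bullet> b - g2 t \<bullet> b) \<in> borel_measurable lebesgue"
      using i by measurable
    show "integrable circle (\<lambda>t. g1 t \<bullet> b - g2 t \<bullet> b)" using i by simp
    show "(\<integral>t. \<phi> t * (g1 t \<bullet> b - g2 t \<bullet> b) \<partial>circle) = 0" if \<phi>: "\<phi> \<in> smooth_T" for \<phi>
    proof -
      have "integrable circle (\<lambda>t. \<phi> t * (g1 t \<bullet> b))" "integrable circle (\<lambda>t. \<phi> t * (g2 t \<bullet> b))"
        using integrable_circle_scaleR[OF smooth_T_continuous_on[OF \<phi>] i(1)]
          integrable_circle_scaleR[OF smooth_T_continuous_on[OF \<phi>] i(3)] by simp_all
      then show ?thesis
        using has_weak_derivative_T_integral[OF 1 \<phi>] has_weak_derivative_T_integral[OF 2 \<phi>]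
        by (simp add: right_diff_distrib)
    qed
  qed
  then have "AE t in circle. \<forall>b\<in>Basis. g1 t \<bullet> b - g2 t \<bullet> b = 0"
    by (intro AE_finite_allI) auto
  then show ?thesis
    by eventually_elim (auto intro: euclidean_eqI)
qed

text \<open>The given \<open>f'\<close> is only known to be integrable, while \<open>H1_T\<close>
  supplies some square-integrable weak derivative \<open>g\<close>. The scalar inequality is summed
  over the coordinates of \<open>g\<close>, and uniqueness transfers the bound to \<open>f'\<close>.
  So the right-hand side is a genuine integral and not the default 0 of a non-integrable
  function.\<close>

lemma wirtinger_H1_T:
  assumes f: "f \<in> H1_T" and weak: "has_weak_derivative_T f f'" and mean: "integral\<^sup>L circle f = 0"
  shows "(\<integral>t. (norm (f t))\<^sup>2 \<partial>circle) \<le> (\<integral>t. (norm (f' t))\<^sup>2 \<partial>circle)"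
proof -
  obtain g where g: "g \<in> L2_T" "has_weak_derivative_T f g" and fL2: "f \<in> L2_T"
    using f by (auto simp: H1_T_def)
  note fi = has_weak_derivative_T_integrable[OF weak] and gi = has_weak_derivative_T_integrable[OF g(2)]
  have norm2: "(norm x)\<^sup>2 = (\<Sum>b\<in>Basis. (x \<bullet> b)\<^sup>2)" for x :: 'a
    by (subst power2_norm_eq_inner, subst euclidean_inner) (simp add: power2_eq_square)
  have int: "integrable circle (\<lambda>t. (u t \<bullet> b)\<^sup>2)"
    if "u \<in> L2_T" "integrable circle u" "b \<in> Basis" for u and b :: 'a
  proof (rule Bochner_Integration.integrable_bound)
    show "integrable circle (\<lambda>t. (norm (u t))\<^sup>2)"
      using that by (simp add: L2_T_def set_integrable_circle)
    show "(\<lambda>t. (u t \<bullet> b)\<^sup>2) \<in> borel_measurable circle"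
      using that(2) by measurable
    have "\<bar>u t \<bullet> b\<bar>\<^sup>2 \<le> (norm (u t))\<^sup>2" for t
      using that(3) by (intro power_mono Basis_le_norm) auto
    then show "AE t in circle. norm ((u t \<bullet> b)\<^sup>2) \<le> norm ((norm (u t))\<^sup>2)"
      by simp
  qed
  have "(\<integral>t. (norm (f t))\<^sup>2 \<partial>circle) = (\<Sum>b\<in>Basis. \<integral>t. (f t \<bullet> b)\<^sup>2 \<partial>circle)"
    unfolding norm2 by (intro Bochner_Integration.integral_sum int fL2 fi)
  also have "\<dots> \<le> (\<Sum>b\<in>Basis. \<integral>t. (g t \<bullet> b)\<^sup>2 \<partial>circle)"
  proof (rule sum_mono)
    fix b :: 'a assume b: "b \<in> Basis"
    show "(\<integral>t. (f t \<bullet> b)\<^sup>2 \<partial>circle) \<le> (\<integral>t. (g t \<bullet> b)\<^sup>2 \<partial>circle)"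
      using fi(1) mean
      by (intro wirtinger_weak_real has_weak_derivative_T_inner[OF g(2)] int fL2 g(1) gi(2) b) simp_all
  qed
  also have "\<dots> = (\<integral>t. (norm (g t))\<^sup>2 \<partial>circle)"
    unfolding norm2 by (intro Bochner_Integration.integral_sum[symmetric] int g gi)
  also have "\<dots> = (\<integral>t. (norm (f' t))\<^sup>2 \<partial>circle)"
  proof (rule integral_cong_AE)
    show "AE t in circle. (norm (g t))\<^sup>2 = (norm (f' t))\<^sup>2"
      using has_weak_derivative_T_unique_AE[OF g(2) weak] by eventually_elim simp
  qed (use fi gi in measurable)
  finally show ?thesis .
qed

section \<open>The symmetries\<close>

text \<open>The substitution t -> 2 pi - t, a reflection followed by a shift, preserves [0, 2 pi],
  so the integral equals its own negative.\<close>

lemma integral_circle_reflect: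
  fixes f :: "real \<Rightarrow> 'a::euclidean_space"
  assumes f: "integrable circle f" and odd: "\<And>t. f (2 * pi - t) = - f t"
  shows "integral\<^sup>L circle f = 0"
proof -
  have "integral {0..2 * pi} f = integral {- (2 * pi)..- 0} (\<lambda>t. f (- t))"
    by (simp only: Henstock_Kurzweil_Integration.integral_reflect_real)
  also have "\<dots> = integral {0..2 * pi} (\<lambda>t. f (- (t + - (2 * pi))))"
    using integral_shift_real_ivl[of "- (2 * pi)" "- (2 * pi)" 0 "\<lambda>t. f (- t)"] by simp
  also have "\<dots> = - integral {0..2 * pi} f"
    by (simp add: odd)
  finally have "integral {0..2 * pi} f = 0"
    by (simp only: eq_neg_iff_add_eq_0 scaleR_2[symmetric]) simp
  then show ?thesis
    using f by (simp add: lebesgue_integral_eq_integral)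
qed

theorem proposition3p7:
  fixes \<gamma> \<gamma>' :: "real \<Rightarrow> real ^ 2"
  assumes "\<gamma> \<in> H1_T"
    and "has_weak_derivative_T \<gamma> \<gamma>'"
    and "\<forall>t. \<gamma> (t + pi) = vector [\<gamma> t $ 1, - (\<gamma> t $ 2)]"
    and "\<forall>t. \<gamma> (pi / 2 + t) = vector [- (\<gamma> (pi / 2 - t) $ 1), \<gamma> (pi / 2 - t) $ 2]"
  shows "(LINT t:{0..2 * pi}|lebesgue. (norm (\<gamma> t))\<^sup>2)
       \<le> (LINT t:{0..2 * pi}|lebesgue. (norm (\<gamma>' t))\<^sup>2)"
proof -
  have "\<gamma> (2 * pi - t) = - \<gamma> t" for t
  proof -
    \<comment> \<open>Read as t -> pi - t, the second symmetry flips the first coordinate; the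
      half-period shift then flips the second and leads to 2 pi - t.\<close>
    have "\<gamma> (pi - t) = vector [- (\<gamma> t $ 1), \<gamma> t $ 2]"
      using assms(4)[rule_format, of "pi / 2 - t"] by simp
    moreover have "\<gamma> (2 * pi - t) = vector [\<gamma> (pi - t) $ 1, - (\<gamma> (pi - t) $ 2)]"
      using assms(3)[rule_format, of "pi - t"] by (simp add: algebra_simps)
    ultimately show ?thesis
      by (simp add: vec_eq_iff forall_2)
  qed
  then have "integral\<^sup>L circle \<gamma> = 0"
    by (intro integral_circle_reflect has_weak_derivative_T_integrable[OF assms(2)])
  from wirtinger_H1_T[OF assms(1,2) this] show ?thesis
    by (simp add: set_lebesgue_integral_circle)
qed

end
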